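(* Let $\mathfrak{L}$ be a left Leibniz algebra over a field $\mathbb{F}$, and let $M$ be an $\mathfrak{L}$-bimodule with associated representation $(\lambda,\rho)$. Let $S$ be a subset of $\mathfrak{L}$ such that for every $s\in S$ the left multiplication operator $L_s:\mathfrak{L}\to\mathfrak{L}$, $x\mapsto sx$, is locally nilpotent. Then: (a) $M_0(S)$ is an $\mathfrak{L}$-subbimodule of $M$. (b) Every element of $S$ acts locally nilpotently on $M_0(S)$ from the left and from the right. Moreover, if $\dim_{\mathbb{F}}M<\infty$, then: (c) $M_1(S)$ is an $\mathfrak{L}$-subbimodule of $M$. (d) $M=M_0(S)\oplus M_1(S)$.
   Context: A left Leibniz algebra over a field $\mathbb{F}$ is an $\mathbb{F}$-vector space $\mathfrak{L}$ (of arbitrary dimension) with a bilinear multiplication satisfying $x(yz)=(xy)z+y(xz)$ for all $x,y,z\in\mathfrak{L}$. An $\mathfrak{L}$-bimodule is an $\mathbb{F}$-vector space $M$ with bilinear left and right actions of $\mathfrak{L}$ such that $(xy)\cdot m=x\cdot(y\cdot m)-y\cdot(x\cdot m)$, $(x\cdot m)\cdot y=x\cdot(m\cdot y)-m\cdot(xy)$, and $(m\cdot x)\cdot y=m\cdot(xy)-x\cdot(m\cdot y)$ for all $m\in M$, $x,y\in\mathfrak{L}$. The associated representation $(\lambda,\rho)$ is given by $\lambda_x(m)=x\cdot m$ and $\rho_x(m)=m\cdot x$. A subbimodule is a subspace stable under both actions. A linear operator $T$ on a vector space $V$ is locally nilpotent if for every $v\in V$ there is a positive integer $n(v)$ with $T^{n(v)}(v)=0$.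 Put $V_0(T):=\bigcup_{n\ge 1}\operatorname{Ker}(T^n)$ and $V_1(T):=\bigcap_{n\ge 1}\operatorname{Im}(T^n)$. For a subset $S\subseteq\mathfrak{L}$ put $M_0(S):=\bigcap_{s\in S}M_0(\lambda_s)$ (equal to $M$ if $S=\emptyset$) and $M_1(S):=\sum_{s\in S}M_1(\lambda_s)$. An element $s$ acts locally nilpotently from the left (right) on a subbimodule if $\lambda_s$ (respectively $\rho_s$) restricted to it is locally nilpotent. *)

theory Defs
  imports Complex_Main
begin

text \<open>Vector spaces are given as whole types with a scalar multiplication satisfying the
  library locale \<^locale>\<open>vector_space\<close>; no restriction on the dimension is made.\<close>

definition bilinear_map ::
  "('f::field \<Rightarrow> 'a::ab_group_add \<Rightarrow> 'a) \<Rightarrow> ('f \<Rightarrow> 'b::ab_group_add \<Rightarrow> 'b)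
    \<Rightarrow> ('f \<Rightarrow> 'c::ab_group_add \<Rightarrow> 'c) \<Rightarrow> ('a \<Rightarrow> 'b \<Rightarrow> 'c) \<Rightarrow> bool"
  where "bilinear_map sa sb sc f \<longleftrightarrow>
    (\<forall>a. Vector_Spaces.linear sb sc (f a)) \<and> (\<forall>b. Vector_Spaces.linear sa sc (\<lambda>a. f a b))"

locale left_leibniz_algebra = vector_space scale
  for scale :: "'f::field \<Rightarrow> 'l::ab_group_add \<Rightarrow> 'l" +
  fixes mult :: "'l \<Rightarrow> 'l \<Rightarrow> 'l"
  assumes mult_bilinear: "bilinear_map scale scale scale mult"
    and left_leibniz: "mult x (mult y z) = mult (mult x y) z + mult y (mult x z)"

text \<open>The left action \<open>lact x m\<close> is \<open>\<lambda>\<^sub>x(m) = x \<cdot> m\<close>; the right action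
  \<open>ract m x\<close> is \<open>\<rho>\<^sub>x(m) = m \<cdot> x\<close>, with the module element as first argument.\<close>

locale leibniz_bimodule =
  L: left_leibniz_algebra scaleL mult + M: vector_space scaleM
  for scaleL :: "'f::field \<Rightarrow> 'l::ab_group_add \<Rightarrow> 'l"
    and mult :: "'l \<Rightarrow> 'l \<Rightarrow> 'l"
    and scaleM :: "'f \<Rightarrow> 'm::ab_group_add \<Rightarrow> 'm" +
  fixes lact :: "'l \<Rightarrow> 'm \<Rightarrow> 'm"
    and ract :: "'m \<Rightarrow> 'l \<Rightarrow> 'm"
  assumes lact_bilinear: "bilinear_map scaleL scaleM scaleM lact"
    and ract_bilinear: "bilinear_map scaleM scaleL scaleM ract"
    and LLM: "lact (mult x y) m = lact x (lact y m) - lact y (lact x m)"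
    and LML: "ract (lact x m) y = lact x (ract m y) - ract m (mult x y)"
    and MLL: "ract (ract m x) y = ract m (mult x y) - lact x (ract m y)"

definition subbimodule ::
  "('f::field \<Rightarrow> 'm::ab_group_add \<Rightarrow> 'm) \<Rightarrow> ('l \<Rightarrow> 'm \<Rightarrow> 'm) \<Rightarrow> ('m \<Rightarrow> 'l \<Rightarrow> 'm)
    \<Rightarrow> 'm set \<Rightarrow> bool"
  where "subbimodule scaleM lact ract N \<longleftrightarrow>
    module.subspace scaleM N \<and> (\<forall>x. \<forall>m\<in>N. lact x m \<in> N \<and> ract m x \<in> N)"

text \<open>Local nilpotency of the restriction of \<open>T\<close> to \<open>W\<close>; the first conjunct says that the
  restriction is indeed an operator on \<open>W\<close>.\<close>

definition locally_nilpotent_on :: "'v::zero set \<Rightarrow> ('v \<Rightarrow> 'v) \<Rightarrow> bool"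
  where "locally_nilpotent_on W T \<longleftrightarrow>
    T ` W \<subseteq> W \<and> (\<forall>v\<in>W. \<exists>n\<ge>1. (T ^^ n) v = 0)"

abbreviation locally_nilpotent :: "('v::zero \<Rightarrow> 'v) \<Rightarrow> bool"
  where "locally_nilpotent T \<equiv> locally_nilpotent_on UNIV T"

definition fitting_null :: "('v::zero \<Rightarrow> 'v) \<Rightarrow> 'v set"
  where "fitting_null T = (\<Union>n\<in>{1..}. {v. (T ^^ n) v = 0})"

definition fitting_one :: "('v \<Rightarrow> 'v) \<Rightarrow> 'v set"
  where "fitting_one T = (\<Inter>n\<in>{1..}. range (T ^^ n))"

text \<open>Sum of a possibly infinite family of subspaces: all finite sums of elements of members.\<close>

definition subspace_sum :: "'i set \<Rightarrow> ('i \<Rightarrow> 'v::comm_monoid_add set) \<Rightarrow> 'v set"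
  where "subspace_sum I A =
    {\<Sum>i\<in>F. f i | F f. finite F \<and> F \<subseteq> I \<and> (\<forall>i\<in>F. f i \<in> A i)}"

text \<open>\<open>M\<^sub>0(S)\<close> and \<open>M\<^sub>1(S)\<close>; for empty \<open>S\<close> these are the whole space and \<open>{0}\<close>.\<close>

definition M0 :: "('l \<Rightarrow> 'm::zero \<Rightarrow> 'm) \<Rightarrow> 'l set \<Rightarrow> 'm set"
  where "M0 lact S = (\<Inter>s\<in>S. fitting_null (lact s))"

definition M1 :: "('l \<Rightarrow> 'm::comm_monoid_add \<Rightarrow> 'm) \<Rightarrow> 'l set \<Rightarrow> 'm set"
  where "M1 lact S = subspace_sum S (\<lambda>s. fitting_one (lact s))"

definition finite_dimensional :: "('f::field \<Rightarrow> 'm::ab_group_add \<Rightarrow> 'm) \<Rightarrow> bool"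
  where "finite_dimensional scaleM \<longleftrightarrow> (\<exists>B. finite_dimensional_vector_space scaleM B)"

text \<open>The whole space is the internal direct sum of the subspaces \<open>A\<close> and \<open>B\<close>.\<close>

definition is_direct_sum ::
  "('f::field \<Rightarrow> 'm::ab_group_add \<Rightarrow> 'm) \<Rightarrow> 'm set \<Rightarrow> 'm set \<Rightarrow> bool"
  where "is_direct_sum scaleM A B \<longleftrightarrow>
    module.subspace scaleM A \<and> module.subspace scaleM B \<and>
    {a + b | a b. a \<in> A \<and> b \<in> B} = UNIV \<and> A \<inter> B = {0}"

end

theory Submission
  imports Defs
begin

text \<open>Both actions \<open>D\<^sub>x\<close> of \<open>x\<close> on the bimodule satisfy \<open>\<lambda>\<^sub>s D\<^sub>x = D\<^bsub>sx\<^esub> + D\<^sub>x \<lambda>\<^sub>s\<close>. When \<open>L\<^sub>s\<close> is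
  locally nilpotent, iterating this rule shows that both Fitting components of \<open>\<lambda>\<^sub>s\<close> are
  subbimodules. Hence the components of \<open>\<lambda>\<^sub>s\<close> are invariant under every \<open>\<lambda>\<^sub>t\<close>, so that the Fitting
  decompositions of finitely many \<open>\<lambda>\<^sub>s\<close> refine one another; in finite dimension \<open>M\<^sub>0(S)\<close> is already
  \<open>M\<^sub>0(F)\<close> for some finite \<open>F \<subseteq> S\<close>. Finally \<open>\<rho>\<^sub>s\<^sup>2 = -\<rho>\<^sub>s \<lambda>\<^sub>s\<close> transfers nilpotency from left to right.\<close>

section \<open>Iterates of maps and pointwise membership in the Fitting components\<close>

lemma additive_funpow:
  fixes T :: "'v::monoid_add \<Rightarrow> 'v"
  assumes "\<And>a b. T (a + b) = T a + T b"
  shows "(T ^^ n) (a + b) = (T ^^ n) a + (T ^^ n) b"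
  by (induction n) (simp_all add: assms)

lemma funpow_eq_0_mono:
  fixes T :: "'v::zero \<Rightarrow> 'v"
  assumes "T 0 = 0" "(T ^^ n) v = 0" "n \<le> k"
  shows "(T ^^ k) v = 0"
  using assms(3)
proof (induction k rule: dec_induct)
  case (step k)
  then show ?case by (simp add: assms(1))
qed (fact assms(2))

text \<open>Admits the exponent 0, which the definition excludes: since \<open>T 0 = 0\<close>, a
  vanishing power may be raised by one. This spares case distinctions later.\<close>

lemma mem_fitting_null:
  fixes T :: "'v::zero \<Rightarrow> 'v"
  assumes "T 0 = 0"
  shows "v \<in> fitting_null T \<longleftrightarrow> (\<exists>n. (T ^^ n) v = 0)"
proof
  assume "\<exists>n. (T ^^ n) v = 0"
  then obtain n where "(T ^^ n) v = 0" ..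
  then have "(T ^^ Suc n) v = 0" by (simp add: assms)
  then show "v \<in> fitting_null T" by (auto simp: fitting_null_def simp del: funpow.simps)
qed (auto simp: fitting_null_def)

lemma mem_fitting_one: "v \<in> fitting_one T \<longleftrightarrow> (\<forall>n. v \<in> range (T ^^ n))"
proof
  assume *: "v \<in> fitting_one T"
  show "\<forall>n. v \<in> range (T ^^ n)"
  proof
    fix n
    show "v \<in> range (T ^^ n)"
    proof (cases n)
      case (Suc k)
      then show ?thesis using * by (auto simp: fitting_one_def simp del: funpow.simps)
    qed simp
  qed
qed (auto simp: fitting_one_def)

section \<open>Stability of Fitting components under generalized derivations\<close>

text \<open>Treats both actions at once: \<open>L\<close> becomes \<open>mult s\<close>,
  \<open>T\<close> becomes \<open>lact s\<close>, and \<open>D\<close> is either the left action or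
  the right action with its arguments swapped.\<close>

locale generalized_derivation =
  fixes L :: "'l::ab_group_add \<Rightarrow> 'l" and T :: "'m::ab_group_add \<Rightarrow> 'm" and D :: "'l \<Rightarrow> 'm \<Rightarrow> 'm"
  assumes T_add: "T (a + b) = T a + T b"
    and D_0_left: "D 0 m = 0" and D_0_right: "D x 0 = 0"
    and derivation: "T (D x m) = D (L x) m + D x (T m)"
begin

lemma T_0: "T 0 = 0"
  using T_add[of 0 0] by simp

text \<open>By the Leibniz expansion, the \<open>n\<close>-th power of \<open>T\<close> sends
  \<open>D x m\<close> to a sum of terms in which \<open>L\<close> hits \<open>x\<close> and
  \<open>T\<close> hits \<open>m\<close> altogether \<open>n\<close> times; for
  \<open>n = p + q\<close> each term has a vanishing argument. Induction on \<open>p + q\<close>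
  replaces the binomial formula, each use of the rule lowering \<open>p\<close> or \<open>q\<close>
  by one.\<close>

lemma funpow_D_eq_0:
  assumes "(L ^^ p) x = 0" "(T ^^ q) m = 0"
  shows "(T ^^ (p + q)) (D x m) = 0"
  using assms
proof (induction "p + q" arbitrary: p q x m)
  case 0
  then show ?case by (simp add: D_0_left)
next
  case (Suc n)
  show ?case
  proof (cases "p = 0 \<or> q = 0")
    case True
    then have "D x m = 0" using Suc.prems by (auto simp: D_0_left D_0_right)
    then show ?thesis using funpow_eq_0_mono[of T 0 0 "p + q"] by (simp add: T_0)
  next
    case False
    then obtain p' q' where p: "p = Suc p'" and q: "q = Suc q'"
      by (metis not0_implies_Suc)
    have "(T ^^ (p' + q)) (D (L x) m) = 0"
      using Suc p by (intro Suc.hyps(1)) (simp_all add: funpow_swap1)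
    moreover have "(T ^^ (p + q')) (D x (T m)) = 0"
      using Suc q by (intro Suc.hyps(1)) (simp_all add: funpow_swap1)
    moreover have "(T ^^ (p + q)) (D x m) = (T ^^ n) (T (D x m))"
      using Suc.hyps(2) by (metis comp_apply funpow_Suc_right)
    moreover have "p' + q = n" "p + q' = n" using Suc.hyps(2) p q by simp_all
    ultimately show ?thesis
      by (simp add: derivation additive_funpow T_add)
  qed
qed

text \<open>The rule is read backwards, as \<open>D x (T w) = T (D x w) - D (L x) w\<close>: a
  \<open>T\<close> either moves outside \<open>D\<close> or is spent on \<open>x\<close>, which
  absorbs fewer than \<open>p\<close> of them before vanishing. The outer induction is on
  \<open>p\<close>, the inner one on \<open>j\<close>.\<close>

lemma D_funpow_in_range:
  assumes "(L ^^ p) x = 0"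
  shows "D x ((T ^^ (j + p)) m) \<in> range (T ^^ j)"
  using assms
proof (induction p arbitrary: x j)
  case 0
  then have "D x ((T ^^ (j + 0)) m) = (T ^^ j) 0"
    using funpow_eq_0_mono[of T 0 0 j] by (simp add: D_0_left T_0)
  then show ?case by (rule range_eqI)
next
  case (Suc p)
  note IH = Suc.IH
  from Suc.prems have L: "(L ^^ p) (L x) = 0" by (simp add: funpow_swap1)
  show ?case
  proof (induction j)
    case (Suc j)
    obtain a where a: "D x ((T ^^ (j + Suc p)) m) = (T ^^ j) a" using Suc by blast
    \<comment> \<open>Since \<open>Suc j + p = j + Suc p\<close>, the exponent lost by passing from
      \<open>x\<close> to \<open>L x\<close> yields one more power outside; hence the outer
      hypothesis is needed at \<open>Suc j\<close>.\<close>
    obtain b where b: "D (L x) ((T ^^ (Suc j + p)) m) = (T ^^ Suc j) b"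
      using IH[OF L, of "Suc j"] by blast
    have "D x ((T ^^ (Suc j + Suc p)) m) = T (D x ((T ^^ (j + Suc p)) m)) - D (L x) ((T ^^ (Suc j + p)) m)"
      by (simp add: derivation)
    also have "\<dots> = (T ^^ Suc j) a - (T ^^ Suc j) b" unfolding a b by simp
    also have "\<dots> = (T ^^ Suc j) (a - b)"
      using additive_funpow[of T "Suc j" "a - b" b, OF T_add] by (simp add: algebra_simps)
    finally show ?case by (rule range_eqI)
  qed simp
qed

lemma fitting_null_stable:
  assumes "\<And>x. \<exists>n. (L ^^ n) x = 0" "m \<in> fitting_null T"
  shows "D x m \<in> fitting_null T"
  using assms funpow_D_eq_0 by (metis T_0 mem_fitting_null)

lemma fitting_one_stable:
  assumes "\<And>x. \<exists>n. (L ^^ n) x = 0" "m \<in> fitting_one T"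
  shows "D x m \<in> fitting_one T"
  unfolding mem_fitting_one
proof
  fix j
  obtain p where "(L ^^ p) x = 0" using assms(1) by blast
  \<comment> \<open>The order \<open>p\<close> depends on \<open>x\<close> alone, so a reserve of
    \<open>p\<close> extra powers suffices for every \<open>j\<close>.\<close>
  moreover obtain w where "m = (T ^^ (j + p)) w"
    using assms(2) by (metis imageE mem_fitting_one)
  ultimately show "D x m \<in> range (T ^^ j)" by (simp add: D_funpow_in_range)
qed

end


section \<open>Fitting components of a linear operator are subspaces\<close>

lemma (in vector_space) linear_fixes_zero:
  assumes "Vector_Spaces.linear scale scale T"
  shows "T 0 = 0"
proof -
  interpret Vector_Spaces.linear scale scale T by (fact assms)
  show ?thesis by (fact zero)
qed

lemma (in vector_space) linear_funpow:
  assumes "Vector_Spaces.linear scale scale T"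
  shows "Vector_Spaces.linear scale scale (T ^^ n)"
proof (induction n)
  case 0
  show ?case using vector_space_axioms by (simp add: Vector_Spaces.linear_iff)
next
  case (Suc n)
  then show ?case using assms by (auto simp: Vector_Spaces.linear_iff)
qed

lemma (in vector_space) subspace_fitting_null:
  assumes "Vector_Spaces.linear scale scale T"
  shows "subspace (fitting_null T)"
proof -
  have lin: "Vector_Spaces.linear scale scale (T ^^ n)" for n
    using assms by (rule linear_funpow)
  have T0: "T 0 = 0" using assms by (rule linear_fixes_zero)
  note mem = mem_fitting_null[of T, OF T0]
  show ?thesis
  proof (rule subspaceI)
    show "0 \<in> fitting_null T" unfolding mem by (rule exI[of _ 0]) simp
    fix a b c
    assume "a \<in> fitting_null T"
    then obtain m where m: "(T ^^ m) a = 0" by (auto simp: mem)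
    have "(T ^^ m) (scale c a) = 0" using lin[of m] m by (simp add: Vector_Spaces.linear_iff)
    then show "scale c a \<in> fitting_null T" unfolding mem by blast
    assume "b \<in> fitting_null T"
    then obtain n where "n \<in> UNIV" and n: "(T ^^ n) b = 0" by (auto simp: mem)
    have "(T ^^ (m + n)) (a + b) = (T ^^ (m + n)) a + (T ^^ (m + n)) b"
      using lin[of "m + n"] by (simp add: Vector_Spaces.linear_iff)
    also have "\<dots> = 0"
      using funpow_eq_0_mono[of T, OF T0 m] funpow_eq_0_mono[of T, OF T0 n] by simp
    finally show "a + b \<in> fitting_null T" unfolding mem by blast
  qed
qed

lemma (in vector_space) subspace_fitting_one:
  assumes "Vector_Spaces.linear scale scale T"
  shows "subspace (fitting_one T)"
  unfolding fitting_one_def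
proof (rule subspace_Int)
  fix n
  interpret Vector_Spaces.linear scale scale "T ^^ n"
    using assms by (rule linear_funpow)
  show "subspace (range (T ^^ n))" by (rule subspace_image) simp
qed

section \<open>Sums of families of subspaces\<close>

lemma (in vector_space) subspace_subspace_sum:
  assumes "\<And>i. i \<in> I \<Longrightarrow> subspace (A i)"
  shows "subspace (subspace_sum I A)"
proof (rule subspaceI)
  show "0 \<in> subspace_sum I A"
    unfolding subspace_sum_def by (rule CollectI, rule exI[of _ "{}"]) auto
next
  fix c a assume "a \<in> subspace_sum I A"
  then obtain F f where *: "a = sum f F" "finite F" "F \<subseteq> I" "\<forall>i\<in>F. f i \<in> A i"
    unfolding subspace_sum_def by blast
  then show "scale c a \<in> subspace_sum I A"
    unfolding subspace_sum_def using assms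
    by (intro CollectI exI[of _ F] exI[of _ "\<lambda>i. scale c (f i)"])
      (auto simp: scale_sum_right intro!: subspace_scale)
next
  fix a b assume "a \<in> subspace_sum I A" "b \<in> subspace_sum I A"
  then obtain F f G g where f: "a = sum f F" "finite F" "F \<subseteq> I" "\<forall>i\<in>F. f i \<in> A i"
    and g: "b = sum g G" "finite G" "G \<subseteq> I" "\<forall>i\<in>G. g i \<in> A i"
    unfolding subspace_sum_def by blast
  \<comment> \<open>The two representations may have different supports; extension by zero puts both
    over \<open>F \<union> G\<close>.\<close>
  define f' g' where "f' = (\<lambda>i. if i \<in> F then f i else 0)" and "g' = (\<lambda>i. if i \<in> G then g i else 0)"
  have "a = sum f' (F \<union> G)" "b = sum g' (F \<union> G)"
    unfolding f(1) g(1) f'_def g'_def using f(2) g(2)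
    by (auto intro!: sum.mono_neutral_cong_left)
  then have "a + b = (\<Sum>i\<in>F \<union> G. f' i + g' i)" by (simp add: sum.distrib)
  moreover have "\<forall>i\<in>F \<union> G. f' i + g' i \<in> A i"
    using f g assms by (auto simp: f'_def g'_def subset_iff intro: subspace_add subspace_0)
  ultimately show "a + b \<in> subspace_sum I A"
    unfolding subspace_sum_def using f(2,3) g(2,3)
    by (intro CollectI exI[of _ "F \<union> G"] exI[of _ "\<lambda>i. f' i + g' i"]) auto
qed

lemma subspace_sum_member:
  fixes A :: "'i \<Rightarrow> 'v::comm_monoid_add set"
  assumes "i \<in> I" "a \<in> A i"
  shows "a \<in> subspace_sum I A"
  unfolding subspace_sum_def using assms
  by (intro CollectI exI[of _ "{i}"] exI[of _ "\<lambda>_. a"]) auto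

lemma subspace_sum_insert:
  fixes A :: "'i \<Rightarrow> 'v::comm_monoid_add set"
  assumes "a \<in> subspace_sum (insert i I) A" "0 \<in> A i"
  obtains b c where "a = b + c" "b \<in> A i" "c \<in> subspace_sum I A"
proof -
  obtain F f where F: "a = sum f F" "finite F" "F \<subseteq> insert i I" "\<forall>j\<in>F. f j \<in> A j"
    using assms(1) unfolding subspace_sum_def by blast
  then have c: "sum f (F - {i}) \<in> subspace_sum I A"
    unfolding subspace_sum_def by blast
  show thesis
  proof (cases "i \<in> F")
    case True
    then show thesis using F c sum.remove[OF F(2) True, of f] that by blast
  next
    case False
    \<comment> \<open>The representation does not involve the index \<open>i\<close>, so its
      component there is 0.\<close>
    then show thesis using F c assms(2) that[of 0 "sum f F"] by simp
  qed
qed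

lemma subspace_sum_mono: "I \<subseteq> J \<Longrightarrow> subspace_sum I A \<subseteq> subspace_sum J A"
  unfolding subspace_sum_def by blast

lemma subspace_sum_stable:
  fixes f :: "'v::comm_monoid_add \<Rightarrow> 'v"
  assumes "\<And>a b. f (a + b) = f a + f b" "f 0 = 0"
    and stable: "\<And>i a. i \<in> I \<Longrightarrow> a \<in> A i \<Longrightarrow> f a \<in> A i"
    and "a \<in> subspace_sum I A"
  shows "f a \<in> subspace_sum I A"
proof -
  obtain F g where g: "a = sum g F" "finite F" "F \<subseteq> I" "\<forall>i\<in>F. g i \<in> A i"
    using assms(4) unfolding subspace_sum_def by blast
  have "f (sum g F) = (\<Sum>i\<in>F. f (g i))"
    using sum_comp_morphism[of f g F] assms(1,2) by (simp add: comp_def)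
  then show ?thesis
    unfolding subspace_sum_def using g stable
    by (intro CollectI exI[of _ F] exI[of _ "\<lambda>i. f (g i)"]) auto
qed

section \<open>Fitting's lemma in finite dimension\<close>

context finite_dimensional_vector_space
begin

text \<open>A member of least dimension is minimal. This serves as the descending chain condition,
  for images of powers and for \<open>M0\<close> of finite sets.\<close>

lemma obtain_minimal_subspace:
  assumes "I \<noteq> {}" "\<And>i. i \<in> I \<Longrightarrow> subspace (A i)"
  obtains i where "i \<in> I" "\<And>j. j \<in> I \<Longrightarrow> A j \<subseteq> A i \<Longrightarrow> A j = A i"
proof -
  obtain i where i: "i \<in> I" "\<And>j. j \<in> I \<Longrightarrow> dim (A i) \<le> dim (A j)"
    using assms(1) ex_has_least_nat[of "\<lambda>i. i \<in> I" _ "\<lambda>i. dim (A i)"] by blast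
  show thesis
  proof
    fix j assume "j \<in> I" "A j \<subseteq> A i"
    then show "A j = A i" using i assms(2) by (intro subspace_dim_equal) auto
  qed (fact i(1))
qed

lemma obtain_maximal_subspace:
  assumes "I \<noteq> {}" "\<And>i. i \<in> I \<Longrightarrow> subspace (A i)"
  obtains i where "i \<in> I" "\<And>j. j \<in> I \<Longrightarrow> A i \<subseteq> A j \<Longrightarrow> A i = A j"
proof -
  obtain i where i: "i \<in> I" "\<And>j. j \<in> I \<Longrightarrow> dim (A j) \<le> dim (A i)"
  proof -
    obtain k where "k \<in> I" using assms(1) by blast
    then show thesis
      \<comment> \<open>\<open>Suc dimension\<close> is a strict upper bound for all the
        dimensions.\<close>
      using ex_has_greatest_nat[of "\<lambda>i. i \<in> I" k "\<lambda>i. dim (A i)" "Suc dimension"] that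
      by (auto simp: less_Suc_eq_le dim_subset_UNIV)
  qed
  show thesis
  proof
    fix j assume "j \<in> I" "A i \<subseteq> A j"
    then show "A i = A j" using i assms(2) by (intro subspace_dim_equal) auto
  qed (fact i(1))
qed

text \<open>Stated relative to an invariant subspace \<open>N\<close> so that an existing component
  can be split further by another operator.\<close>

lemma fitting_decomposition:
  assumes T: "Vector_Spaces.linear scale scale T"
    and N: "subspace N" "T ` N \<subseteq> N" and "v \<in> N"
  obtains a b where "v = a + b" "a \<in> N" "b \<in> N" "a \<in> fitting_null T" "b \<in> fitting_one T"
proof -
  have lin: "Vector_Spaces.linear scale scale (T ^^ n)" for n
    using T by (rule linear_funpow)
  have sub: "subspace ((T ^^ n) ` N)" for n
  proof -
    interpret Vector_Spaces.linear scale scale "T ^^ n" by (rule lin)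
    show ?thesis using N(1) by (rule subspace_image)
  qed
  have step: "(T ^^ Suc n) ` N \<subseteq> (T ^^ n) ` N" for n
    using N(2) by (auto simp: funpow_swap1)
  have anti: "(T ^^ k) ` N \<subseteq> (T ^^ n) ` N" if "n \<le> k" for n k
    using that step by (rule lift_Suc_antimono_le[rotated])
  obtain n where "n \<in> UNIV" and n: "\<And>k. k \<in> UNIV \<Longrightarrow> (T ^^ k) ` N \<subseteq> (T ^^ n) ` N \<Longrightarrow> (T ^^ k) ` N = (T ^^ n) ` N"
    by (rule obtain_minimal_subspace[OF UNIV_not_empty, of "\<lambda>n. (T ^^ n) ` N", OF sub]) (rule that)
  have eq: "(T ^^ (n + k)) ` N = (T ^^ n) ` N" for k
    by (rule n[OF UNIV_I], rule anti) simp
  \<comment> \<open>The images of \<open>N\<close> are constant from exponent \<open>n\<close> on,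
    so \<open>T ^^ n\<close> maps its own image of \<open>N\<close> onto itself. Thus
    \<open>v\<close> agrees modulo the kernel of \<open>T ^^ n\<close> with some \<open>b\<close> in
    that image.\<close>
  have "(T ^^ n) v \<in> (T ^^ (n + n)) ` N" using \<open>v \<in> N\<close> eq by blast
  then obtain w where w: "w \<in> N" "(T ^^ n) v = (T ^^ n) ((T ^^ n) w)"
    by (auto simp: funpow_add)
  define b where "b = (T ^^ n) w"
  have b: "b \<in> (T ^^ n) ` N" using w(1) by (simp add: b_def)
  show thesis
  proof
    show "v = (v - b) + b" by simp
    show "b \<in> N" using b anti[of 0 n] by auto
    then show "v - b \<in> N" using \<open>v \<in> N\<close> N(1) by (simp add: subspace_diff)
    have "T 0 = 0" using T by (rule linear_fixes_zero)
    interpret Vector_Spaces.linear scale scale "T ^^ n" by (rule lin)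
    have "(T ^^ n) (v - b) = 0" using w(2) by (simp add: diff b_def)
    then show "v - b \<in> fitting_null T"
      using \<open>T 0 = 0\<close> by (auto simp: mem_fitting_null)
    have "b \<in> range (T ^^ k)" for k
      using b eq[of k] anti[of k "n + k"] by auto
    then show "b \<in> fitting_one T" by (simp add: mem_fitting_one)
  qed
qed

text \<open>The kernels of the powers stabilise at some \<open>n\<close>. Writing
  \<open>v = (T ^^ n) w\<close>, a power of \<open>T\<close> that kills \<open>v\<close> puts
  \<open>w\<close> into a later kernel, hence already into that of \<open>T ^^ n\<close>.\<close>

lemma fitting_null_Int_fitting_one:
  assumes T: "Vector_Spaces.linear scale scale T"
    and v: "v \<in> fitting_null T" "v \<in> fitting_one T"
  shows "v = 0"
proof -
  have lin: "Vector_Spaces.linear scale scale (T ^^ n)" for n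
    using T by (rule linear_funpow)
  have T0: "T 0 = 0" using T by (rule linear_fixes_zero)
  have sub: "subspace {x. (T ^^ n) x = 0}" for n
  proof -
    interpret Vector_Spaces.linear scale scale "T ^^ n" by (rule lin)
    show ?thesis by (rule subspace_kernel)
  qed
  obtain n where "n \<in> UNIV" and n: "\<And>k. k \<in> UNIV \<Longrightarrow> {x. (T ^^ n) x = 0} \<subseteq> {x. (T ^^ k) x = 0} \<Longrightarrow>
      {x. (T ^^ n) x = 0} = {x. (T ^^ k) x = 0}"
    by (rule obtain_maximal_subspace[OF UNIV_not_empty, of "\<lambda>n. {x. (T ^^ n) x = 0}", OF sub]) (rule that)
  obtain m where m: "(T ^^ m) v = 0" using v(1) T0 by (auto simp: mem_fitting_null)
  obtain w where w: "v = (T ^^ n) w" using v(2) by (auto simp: mem_fitting_one)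
  have "(T ^^ (m + n)) w = 0" using m w by (simp add: funpow_add)
  moreover have "{x. (T ^^ n) x = 0} \<subseteq> {x. (T ^^ (m + n)) x = 0}"
    using funpow_eq_0_mono[of T, OF T0] by auto
  ultimately show "v = 0" using n w by blast
qed

end

section \<open>Fitting components of bimodules\<close>

context leibniz_bimodule
begin

lemma lact_linear: "Vector_Spaces.linear scaleM scaleM (lact x)"
  using lact_bilinear by (simp add: bilinear_map_def)

lemma ract_linear: "Vector_Spaces.linear scaleM scaleM (\<lambda>m. ract m x)"
  using ract_bilinear by (simp add: bilinear_map_def)

lemma lact_add: "lact x (a + b) = lact x a + lact x b"
  and ract_add: "ract (a + b) x = ract a x + ract b x"
  using lact_linear ract_linear by (simp_all add: Vector_Spaces.linear_iff)

lemma lact_zero: "lact x 0 = 0" "lact 0 m = 0"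
  and ract_zero: "ract 0 x = 0" "ract m 0 = 0"
  using lact_bilinear ract_bilinear unfolding bilinear_map_def Vector_Spaces.linear_iff
  by (metis add_cancel_right_right)+

text \<open>The derivation rule is \<open>LLM\<close> solved for \<open>lact s (lact x m)\<close>;
  for the right action it is \<open>LML\<close> solved for \<open>lact s (ract m x)\<close>.\<close>

lemma lact_derivation: "generalized_derivation (mult s) (lact s) lact"
  by unfold_locales (simp_all add: lact_add lact_zero LLM)

lemma ract_derivation: "generalized_derivation (mult s) (lact s) (\<lambda>x m. ract m x)"
  by unfold_locales (simp_all add: lact_add ract_zero LML)

text \<open>Up to sign, all but one of the right actions by \<open>s\<close> can be exchanged for
  left actions. The one that remains accounts for \<open>Suc n\<close>.\<close>

lemma ract_funpow_eq_0:
  assumes "(lact s ^^ n) m = 0"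
  shows "((\<lambda>m. ract m s) ^^ Suc n) m = 0"
  using assms
proof (induction n arbitrary: m)
  case 0
  then show ?case by (simp add: ract_zero)
next
  case (Suc n)
  interpret R: Vector_Spaces.linear scaleM scaleM "(\<lambda>m. ract m s) ^^ n"
    using ract_linear by (rule M.linear_funpow)
  \<comment> \<open>The right-hand sides of \<open>MLL\<close> and \<open>LML\<close> at
    \<open>x = y = s\<close> are negatives of each other.\<close>
  have "ract (ract m s) s = - ract (lact s m) s"
    by (simp add: MLL LML)
  then have "((\<lambda>m. ract m s) ^^ Suc (Suc n)) m = - ((\<lambda>m. ract m s) ^^ Suc n) (lact s m)"
    by (simp add: funpow_Suc_right R.neg del: funpow.simps(2))
  also have "\<dots> = 0"
    using Suc.IH[of "lact s m"] Suc.prems by (simp add: funpow_Suc_right del: funpow.simps)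
  finally show ?case .
qed

lemma subspace_M0: "M.subspace (M0 lact S)"
  unfolding M0_def using lact_linear
  by (intro M.subspace_Int M.subspace_fitting_null)

lemma subspace_M1: "M.subspace (M1 lact S)"
  unfolding M1_def using lact_linear
  by (intro M.subspace_subspace_sum M.subspace_fitting_one)

lemma subbimodule_M0:
  assumes "\<And>s x. s \<in> S \<Longrightarrow> \<exists>n. (mult s ^^ n) x = 0"
  shows "subbimodule scaleM lact ract (M0 lact S)"
  unfolding subbimodule_def using subspace_M0 assms
  by (auto simp: M0_def intro: generalized_derivation.fitting_null_stable[OF lact_derivation]
      generalized_derivation.fitting_null_stable[OF ract_derivation])

lemma subbimodule_M1:
  assumes "\<And>s x. s \<in> S \<Longrightarrow> \<exists>n. (mult s ^^ n) x = 0"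
  shows "subbimodule scaleM lact ract (M1 lact S)"
  unfolding subbimodule_def
proof (intro conjI allI ballI)
  fix x m assume m: "m \<in> M1 lact S"
  show "lact x m \<in> M1 lact S"
    unfolding M1_def
    by (rule subspace_sum_stable[of "lact x"])
      (use m assms in \<open>auto simp: lact_add lact_zero M1_def
        intro: generalized_derivation.fitting_one_stable[OF lact_derivation]\<close>)
  show "ract m x \<in> M1 lact S"
    unfolding M1_def
    by (rule subspace_sum_stable[of "\<lambda>m. ract m x"])
      (use m assms in \<open>auto simp: ract_add ract_zero M1_def
        intro: generalized_derivation.fitting_one_stable[OF ract_derivation]\<close>)
qed (fact subspace_M1)

lemma locally_nilpotent_on_M0:
  assumes nil: "\<And>s x. s \<in> S \<Longrightarrow> \<exists>n. (mult s ^^ n) x = 0" and s: "s \<in> S"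
  shows "locally_nilpotent_on (M0 lact S) (lact s)"
    and "locally_nilpotent_on (M0 lact S) (\<lambda>m. ract m s)"
proof -
  have stable: "lact x ` M0 lact S \<subseteq> M0 lact S" "(\<lambda>m. ract m x) ` M0 lact S \<subseteq> M0 lact S" for x
    using subbimodule_M0[OF nil] by (auto simp: subbimodule_def)
  have L: "\<exists>n\<ge>1. (lact s ^^ n) m = 0" if "m \<in> M0 lact S" for m
    using that s by (auto simp: M0_def fitting_null_def)
  then show "locally_nilpotent_on (M0 lact S) (lact s)"
    using stable by (auto simp: locally_nilpotent_on_def)
  have "\<exists>n\<ge>1. ((\<lambda>m. ract m s) ^^ n) m = 0" if "m \<in> M0 lact S" for m
    using L[OF that] ract_funpow_eq_0 by (metis One_nat_def le_add1 plus_1_eq_Suc)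
  then show "locally_nilpotent_on (M0 lact S) (\<lambda>m. ract m s)"
    using stable by (simp add: locally_nilpotent_on_def)
qed

section \<open>Reduction to finite subsets and the direct sum\<close>

lemma M0_finite_subset:
  assumes "finite_dimensional scaleM"
  obtains F where "finite F" "F \<subseteq> S" "M0 lact F = M0 lact S"
proof -
  obtain B where "finite_dimensional_vector_space scaleM B"
    using assms by (auto simp: finite_dimensional_def)
  then interpret F: finite_dimensional_vector_space scaleM B .
  have "{F. finite F \<and> F \<subseteq> S} \<noteq> {}" by blast
  then obtain F where F: "F \<in> {F. finite F \<and> F \<subseteq> S}"
    and min: "\<And>G. G \<in> {F. finite F \<and> F \<subseteq> S} \<Longrightarrow> M0 lact G \<subseteq> M0 lact F \<Longrightarrow> M0 lact G = M0 lact F"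
    by (rule F.obtain_minimal_subspace[of _ "M0 lact", OF _ subspace_M0]) (rule that)
  have "M0 lact F \<subseteq> fitting_null (lact s)" if "s \<in> S" for s
  proof -
    \<comment> \<open>Enlarging \<open>F\<close> can only shrink \<open>M0\<close>, and minimality
      forbids a proper shrinking.\<close>
    have "M0 lact (insert s F) = M0 lact F"
      using F that min[of "insert s F"] by (auto simp: M0_def)
    then show ?thesis by (auto simp: M0_def)
  qed
  then have "M0 lact F = M0 lact S" using F by (auto simp: M0_def)
  with F show thesis using that by blast
qed

lemma M0_plus_M1_finite:
  assumes nil: "\<And>s x. s \<in> F \<Longrightarrow> \<exists>n. (mult s ^^ n) x = 0"
    and fd: "finite_dimensional scaleM" and "finite F"
  shows "\<exists>a\<in>M0 lact F. \<exists>b\<in>M1 lact F. v = a + b"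
  using \<open>finite F\<close> nil
proof (induction F rule: finite_induct)
  case empty
  have "0 \<in> M1 lact {}" by (rule M.subspace_0[OF subspace_M1])
  then show ?case by (intro bexI[of _ v] bexI[of _ 0]) (simp_all add: M0_def)
next
  case (insert s F)
  obtain B where "finite_dimensional_vector_space scaleM B"
    using fd by (auto simp: finite_dimensional_def)
  then interpret F: finite_dimensional_vector_space scaleM B .
  obtain a b where a: "a \<in> M0 lact F" and b: "b \<in> M1 lact F" and v: "v = a + b"
    using insert by blast
  \<comment> \<open>Invariance lets \<open>a\<close> be split by \<open>lact s\<close> inside
    \<open>M0 lact F\<close>: the null part stays in every earlier null component, and the other
    part moves into \<open>M1\<close>.\<close>
  have "lact s ` M0 lact F \<subseteq> M0 lact F"
    using subbimodule_M0[of F] insert.prems by (auto simp: subbimodule_def)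
  then obtain a0 a1 where a01: "a = a0 + a1" "a0 \<in> M0 lact F" "a0 \<in> fitting_null (lact s)"
    "a1 \<in> fitting_one (lact s)"
    using F.fitting_decomposition[OF lact_linear subspace_M0 _ a] by blast
  have "a0 \<in> M0 lact (insert s F)" using a01 by (simp add: M0_def)
  moreover have "a1 \<in> M1 lact (insert s F)"
    unfolding M1_def using a01 by (intro subspace_sum_member[of s]) auto
  moreover have "b \<in> M1 lact (insert s F)"
    using b subspace_sum_mono[of F "insert s F"] by (auto simp: M1_def)
  ultimately show ?case
    using v a01(1) M.subspace_add[OF subspace_M1] by (metis add.assoc)
qed

lemma M0_Int_M1_finite:
  assumes nil: "\<And>s x. s \<in> F \<Longrightarrow> \<exists>n. (mult s ^^ n) x = 0"
    and fd: "finite_dimensional scaleM" and "finite F"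
    and "v \<in> M0 lact F" "v \<in> M1 lact F"
  shows "v = 0"
  using \<open>finite F\<close> nil assms(4,5)
proof (induction F rule: finite_induct)
  case empty
  then show ?case by (simp add: M1_def subspace_sum_def)
next
  case (insert s F)
  obtain B where "finite_dimensional_vector_space scaleM B"
    using fd by (auto simp: finite_dimensional_def)
  then interpret F: finite_dimensional_vector_space scaleM B .
  note null = M.subspace_fitting_null[OF lact_linear[of s]]
    and one = M.subspace_fitting_one[OF lact_linear[of s]]
  obtain w u where v: "v = w + u" and w: "w \<in> fitting_one (lact s)" and u: "u \<in> M1 lact F"
    using insert.prems(3) M.subspace_0[OF one] unfolding M1_def by (rule subspace_sum_insert)
  have "lact s ` M1 lact F \<subseteq> M1 lact F"
    using subbimodule_M1[of F] insert.prems by (auto simp: subbimodule_def)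
  then obtain u0 u1 where u01: "u = u0 + u1" "u0 \<in> M1 lact F" "u0 \<in> fitting_null (lact s)"
    "u1 \<in> fitting_one (lact s)"
    using F.fitting_decomposition[OF lact_linear subspace_M1 _ u] by blast
  \<comment> \<open>The difference \<open>v - u0\<close> equals \<open>w + u1\<close>, so it lies in
    both components of \<open>lact s\<close> and vanishes. Then \<open>v = u0\<close> is in
    \<open>M1 lact F\<close>, where the induction hypothesis applies.\<close>
  have "v - u0 \<in> fitting_null (lact s)"
    using insert.prems(2) u01(3) M.subspace_diff[OF null] by (simp add: M0_def)
  moreover have "v - u0 \<in> fitting_one (lact s)"
    using v u01(1,4) w M.subspace_add[OF one] by (simp add: algebra_simps)
  ultimately have "v - u0 = 0"
    by (rule F.fitting_null_Int_fitting_one[OF lact_linear])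
  then have "v \<in> M1 lact F" using u01(2) by simp
  moreover have "v \<in> M0 lact F" using insert.prems(2) by (simp add: M0_def)
  ultimately show "v = 0" using insert by blast
qed

text \<open>Two different finite sets are used: for spanning, one that already cuts out
  \<open>M0 lact S\<close>; for trivial intersection, the finite support of the given element of
  \<open>M1 lact S\<close>.\<close>

lemma is_direct_sum_M0_M1:
  assumes nil: "\<And>s x. s \<in> S \<Longrightarrow> \<exists>n. (mult s ^^ n) x = 0"
    and fd: "finite_dimensional scaleM"
  shows "is_direct_sum scaleM (M0 lact S) (M1 lact S)"
  unfolding is_direct_sum_def
proof (intro conjI)
  show "{a + b |a b. a \<in> M0 lact S \<and> b \<in> M1 lact S} = UNIV"
  proof (intro UNIV_eq_I[symmetric])
    fix v
    obtain F where F: "finite F" "F \<subseteq> S" "M0 lact F = M0 lact S"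
      using fd by (rule M0_finite_subset)
    then obtain a b where "a \<in> M0 lact S" "b \<in> M1 lact F" "v = a + b"
      using M0_plus_M1_finite[of F v] nil fd by (metis subsetD)
    then show "v \<in> {a + b |a b. a \<in> M0 lact S \<and> b \<in> M1 lact S}"
      using subspace_sum_mono[OF F(2)] unfolding M1_def by blast
  qed
  have "v = 0" if v: "v \<in> M0 lact S" "v \<in> M1 lact S" for v
  proof -
    obtain F where F: "finite F" "F \<subseteq> S" "v \<in> M1 lact F"
      using v(2) unfolding M1_def subspace_sum_def by blast
    moreover have "v \<in> M0 lact F" using v(1) F(2) by (auto simp: M0_def)
    ultimately show ?thesis using M0_Int_M1_finite[of F v] nil fd by blast
  qed
  then show "M0 lact S \<inter> M1 lact S = {0}"
    using M.subspace_0[OF subspace_M0] M.subspace_0[OF subspace_M1] by blast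
qed (fact subspace_M0 subspace_M1)+

end

theorem theorem2p3:
  fixes scaleL :: "'f::field \<Rightarrow> 'l::ab_group_add \<Rightarrow> 'l"
    and mult :: "'l \<Rightarrow> 'l \<Rightarrow> 'l"
    and scaleM :: "'f \<Rightarrow> 'm::ab_group_add \<Rightarrow> 'm"
    and lact :: "'l \<Rightarrow> 'm \<Rightarrow> 'm"
    and ract :: "'m \<Rightarrow> 'l \<Rightarrow> 'm"
    and S :: "'l set"
  assumes "leibniz_bimodule scaleL mult scaleM lact ract"
    and "\<And>s. s \<in> S \<Longrightarrow> locally_nilpotent (\<lambda>x. mult s x)"
  shows "subbimodule scaleM lact ract (M0 lact S) \<and>
    (\<forall>s\<in>S. locally_nilpotent_on (M0 lact S) (\<lambda>m. lact s m) \<and>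
           locally_nilpotent_on (M0 lact S) (\<lambda>m. ract m s)) \<and>
    (finite_dimensional scaleM \<longrightarrow>
      subbimodule scaleM lact ract (M1 lact S) \<and>
      is_direct_sum scaleM (M0 lact S) (M1 lact S))"
proof -
  interpret leibniz_bimodule scaleL mult scaleM lact ract by (fact assms(1))
  have nil: "\<exists>n. (mult s ^^ n) x = 0" if "s \<in> S" for s x
    using assms(2)[OF that] by (auto simp: locally_nilpotent_on_def)
  show ?thesis
    using subbimodule_M0[of S] locally_nilpotent_on_M0[of S] subbimodule_M1[of S]
      is_direct_sum_M0_M1[of S] nil
    by simp
qed

end
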